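(* Assume that $r$ is prime or $r=4$, and let $(A_i^j)_{i,j=1}^r$, $A_i^j\subseteq\Delta^{r-1}$, be a matrix of closed, covering preferences satisfying the condition $\mathbf{P_{dte}}$ (all degenerate tiles are equal). Degenerate tiles may be preferred by some players. Assume also that there exists $\varepsilon>0$ such that a non-degenerate tile $r$ shorter than $\varepsilon$ is never preferred, i.e. for all $j\in[r]$ and $z\in\Delta^{r-1}$, if $0<z_r<\varepsilon$ then $z\notin A_r^j$. Then there exists an envy-free division in which each player gets a preferred tile (or nothing, if he prefers so), and at most one tile is dropped. That is, there exist a cut $z\in\Delta^{r-1}$ and a map $\tau:[r]\to[r]\cup\{\emptyset\}$ (from players to tiles or "nothing") such that: (1) if $\tau(j)=i\in[r]$, then tile $i$ is non-degenerate in $z$ and $z\in A_i^j$; (2) if $\tau(j)=\emptyset$, then there is a degenerate tile $m$ in the cut $z$ with $z\in A_m^j$; (3) each non-degenerate tile of $z$ is assigned by $\tau$ to at most one player; (4) at most one non-degenerate tile of $z$ is not assigned to any player.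
   Context: Notation: $[r]=\{1,\dots,r\}$. A cut of $[0,1]$ by $r-1$ cut-points $0\le x_1\le\dots\le x_{r-1}\le 1$ (with $x_0=0$, $x_r=1$) produces tiles $I_t=[x_{t-1},x_t]$, $t\in[r]$, and is recorded by the vector of lengths $z=(z_1,\dots,z_r)$, $z_t=x_t-x_{t-1}$, a point of the standard simplex $\Delta^{r-1}=\{z\in\mathbb{R}^r: z_t\ge 0,\ \sum_t z_t=1\}$. Tile $t$ is degenerate in the cut $z$ if $z_t=0$. A matrix $(A_i^j)_{i,j=1}^r$ of subsets of $\Delta^{r-1}$ is interpreted as preferences of $r$ players: $z\in A_i^j$ means that in the cut $z$ player $j$ prefers tile $i$. The preferences are closed if every $A_i^j$ is closed in $\Delta^{r-1}$; covering if $\bigcup_{i=1}^r A_i^j=\Delta^{r-1}$ for every $j$. Condition $\mathbf{P_{dte}}$: for every player $j$ and every cut $z$, if $m,m'$ are degenerate tiles of $z$, then $z\in A_m^j\Leftrightarrow z\in A_{m'}^j$. A degenerate tile is regarded as "nothing" (an empty piece). A tile is dropped if it is non-degenerate and is not given to any player. *)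

theory Defs
  imports "HOL-Homology.Simplices" "HOL-Computational_Algebra.Primes"
begin

text \<open>
  Players and tiles are numbered from 0, so that \<open>{..<r}\<close> plays the role of $[r] = \{1,\dots,r\}$
  and the last tile, tile $r$, has index \<open>r - 1\<close>.  A cut of the unit interval is recorded by its
  vector \<open>z\<close> of tile lengths, a point of the simplex $\Delta^{r-1}$, for which we take
  \<^const>\<open>standard_simplex\<close> (vectors \<open>nat \<Rightarrow> real\<close> vanishing beyond index \<open>r - 1\<close>; the subspace
  topology is the Euclidean one).  All notions are meant for \<open>r > 0\<close>.

  In \<open>A i j\<close>, as in $A_i^j$, the first index is the tile and the second one is the player.
\<close>

definition cuts :: "nat \<Rightarrow> (nat \<Rightarrow> real) set" where
  "cuts r = standard_simplex (r - 1)"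

definition degenerate :: "(nat \<Rightarrow> real) \<Rightarrow> nat \<Rightarrow> bool" where
  "degenerate z t \<longleftrightarrow> z t = 0"

type_synonym preferences = "nat \<Rightarrow> nat \<Rightarrow> (nat \<Rightarrow> real) set"

definition closed_preferences :: "nat \<Rightarrow> preferences \<Rightarrow> bool" where
  "closed_preferences r A \<longleftrightarrow> (\<forall>i<r. \<forall>j<r. closedin (top_of_set (cuts r)) (A i j))"

definition covering_preferences :: "nat \<Rightarrow> preferences \<Rightarrow> bool" where
  "covering_preferences r A \<longleftrightarrow> (\<forall>j<r. (\<Union>i<r. A i j) = cuts r)"

definition P_dte :: "nat \<Rightarrow> preferences \<Rightarrow> bool" where
  "P_dte r A \<longleftrightarrow>
    (\<forall>j<r. \<forall>z\<in>cuts r. \<forall>m<r. \<forall>m'<r.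
      degenerate z m \<longrightarrow> degenerate z m' \<longrightarrow> (z \<in> A m j \<longleftrightarrow> z \<in> A m' j))"

text \<open>
  An assignment \<open>\<tau>\<close> of tiles to players has type \<^typ>\<open>nat \<Rightarrow> nat option\<close>, where \<^term>\<open>None\<close> stands for
  ``nothing''; only its values on the players \<open>{..<r}\<close> matter.
\<close>

definition dropped :: "nat \<Rightarrow> (nat \<Rightarrow> real) \<Rightarrow> (nat \<Rightarrow> nat option) \<Rightarrow> nat \<Rightarrow> bool" where
  "dropped r z \<tau> i \<longleftrightarrow> i < r \<and> \<not> degenerate z i \<and> (\<forall>j<r. \<tau> j \<noteq> Some i)"

end

theory Submission
  imports Defs "HOL-Analysis.Brouwer_Fixpoint"
begin

text \<open>
  Spread each player's preference over the tiles by a partition of unity subordinate to small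
  neighbourhoods of the sets \<open>A i j\<close>, and let \<open>F z i\<close> be the total demand for tile \<open>i\<close>; the demands
  sum to the number of tiles.  Label a vertex \<open>z\<close> of a fine triangulation by a non-degenerate tile
  \<open>i\<close> with \<open>F z i > 1\<close>, or by \<open>*\<close> if there is none.  If on a face with tiles \<open>0, \<dots>, n\<close> no small simplex
  carries \<open>*\<close> together with all labels below \<open>n\<close>, then the parity argument of Sperner's lemma
  climbs from that face to the next one.  So there is a simplex that either carries all labels of the
  whole simplex, or carries \<open>*\<close> and the labels \<open>0, \<dots>, n - 1\<close> in such a face.  In both cases, up to
  a small error, no non-degenerate tile is demanded more than once, and the total demand for the
  non-degenerate tiles is at least their number minus one.  By Hall's theorem such demands
  can be rounded to an assignment that drops at most one tile, and compactness removes the errors.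
\<close>

section \<open>Hall's marriage theorem\<close>

text \<open>Halmos-Vaughan induction. A proper nonempty subset with exactly as many neighbours as
  elements is matched first, and the rest avoids its neighbours. If no such tight set exists, one
  element may take any neighbour.\<close>

lemma hall_marriage:
  fixes E :: "'a \<Rightarrow> 'b set"
  assumes "finite I" and "\<And>i. i \<in> I \<Longrightarrow> finite (E i)"
    and "\<And>S. S \<subseteq> I \<Longrightarrow> card S \<le> card (\<Union>(E ` S))"
  shows "\<exists>\<pi>. inj_on \<pi> I \<and> (\<forall>i\<in>I. \<pi> i \<in> E i)"
  using assms
proof (induction "card I" arbitrary: I E rule: less_induct)
  case less
  note fin = less.prems(1,2) and hall = less.prems(3)
  show ?case
  proof (cases "I = {}")
    case True
    then show ?thesis by auto
  next
    case False
    show ?thesis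
    proof (cases "\<exists>S. S \<noteq> {} \<and> S \<subset> I \<and> card (\<Union>(E ` S)) = card S")
      case True
      then obtain S where S: "S \<noteq> {}" "S \<subset> I" "card (\<Union>(E ` S)) = card S" by blast
      define U where "U = \<Union>(E ` S)"
      have finS: "finite S"
        using S(2) fin(1) by (meson finite_subset psubset_imp_subset)
      have finU: "finite U"
        using S(2) fin(2) finS by (auto simp: U_def)
      have "\<exists>\<pi>. inj_on \<pi> S \<and> (\<forall>i\<in>S. \<pi> i \<in> E i)"
        using S(2) fin hall finS by (intro less.hyps psubset_card_mono) auto
      then obtain \<pi>1 where \<pi>1: "inj_on \<pi>1 S" "\<forall>i\<in>S. \<pi>1 i \<in> E i" by blast
      have "\<exists>\<pi>. inj_on \<pi> (I - S) \<and> (\<forall>i\<in>I - S. \<pi> i \<in> E i - U)"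
      proof (rule less.hyps)
        show "card (I - S) < card I"
          using S(1,2) fin(1) by (intro psubset_card_mono) auto
        fix T assume T: "T \<subseteq> I - S"
        have "finite T" using T fin(1) finite_subset by blast
        have eq: "(\<Union>i\<in>T. E i - U) = \<Union>(E ` (T \<union> S)) - U"
          by (auto simp: U_def)
        \<comment> \<open>Hall's condition for \<open>T \<union> S\<close>, minus the
          \<open>card S\<close> neighbours that tightness reserves for \<open>S\<close>, leaves
          enough for \<open>T\<close>.\<close>
        have "card T + card S = card (T \<union> S)"
          using T \<open>finite T\<close> finS by (subst card_Un_disjoint) auto
        also have "\<dots> \<le> card (\<Union>(E ` (T \<union> S)))"
          using T S(2) by (intro hall) auto
        also have "\<dots> = card (\<Union>(E ` (T \<union> S)) - U) + card U"
        proof -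
          have "U \<subseteq> \<Union>(E ` (T \<union> S))" by (auto simp: U_def)
          moreover have "finite (\<Union>(E ` (T \<union> S)))"
            using T S(2) fin \<open>finite T\<close> finS by auto
          ultimately show ?thesis
            by (simp add: card_Diff_subset finU card_mono)
        qed
        finally show "card T \<le> card (\<Union>i\<in>T. E i - U)"
          using S(3) unfolding eq U_def[symmetric] by linarith
      qed (use fin in auto)
      then obtain \<pi>2 where \<pi>2: "inj_on \<pi>2 (I - S)" "\<forall>i\<in>I - S. \<pi>2 i \<in> E i - U" by blast
      have "inj_on (\<lambda>i. if i \<in> S then \<pi>1 i else \<pi>2 i) I"
        using \<pi>1 \<pi>2 unfolding inj_on_def U_def by (smt (verit) DiffE DiffI UN_I)
      moreover have "\<forall>i\<in>I. (if i \<in> S then \<pi>1 i else \<pi>2 i) \<in> E i"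
        using \<pi>1 \<pi>2 by auto
      ultimately show ?thesis by blast
    next
      case no_tight: False
      obtain i where i: "i \<in> I" using False by blast
      have "card {i} \<le> card (\<Union>(E ` {i}))" using i by (intro hall) auto
      then obtain e where e: "e \<in> E i" by fastforce
      have "\<exists>\<pi>. inj_on \<pi> (I - {i}) \<and> (\<forall>k\<in>I - {i}. \<pi> k \<in> E k - {e})"
      proof (rule less.hyps)
        show "card (I - {i}) < card I"
          using i fin(1) by (rule card_Diff1_less[rotated])
        fix T assume T: "T \<subseteq> I - {i}"
        show "card T \<le> card (\<Union>k\<in>T. E k - {e})"
        proof (cases "T = {}")
          case False
          \<comment> \<open>Since \<open>T\<close> is not tight, it has a spare neighbour, so losing
            \<open>e\<close> does no harm.\<close>
          have "T \<subset> I" using T i by blast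
          then have "card T < card (\<Union>(E ` T))"
            using no_tight False hall[of T] by (metis le_neq_implies_less psubset_imp_subset)
          moreover have "(\<Union>k\<in>T. E k - {e}) = \<Union>(E ` T) - {e}" by blast
          ultimately show ?thesis
            by (simp add: card_Diff_singleton_if) linarith
        qed simp
      qed (use fin in auto)
      then obtain \<pi> where \<pi>: "inj_on \<pi> (I - {i})" "\<forall>k\<in>I - {i}. \<pi> k \<in> E k - {e}" by blast
      have "inj_on (\<pi>(i := e)) I"
        using \<pi> unfolding inj_on_def by auto
      moreover have "\<forall>k\<in>I. (\<pi>(i := e)) k \<in> E k"
        using \<pi> e by auto
      ultimately show ?thesis by blast
    qed
  qed
qed

section \<open>The product metric\<close>

text \<open>The distance of functions is a series of capped coordinate distances with weights
  \<open>(1/2)^n\<close>; the factor 2 is the sum of the weights.\<close>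

lemma dist_fun_le:
  fixes x y :: "nat \<Rightarrow> 'a::metric_space"
  assumes "\<And>i. dist (x i) (y i) \<le> e"
  shows "dist x y \<le> 2 * e"
proof -
  have summ: "summable (\<lambda>n. (1/2::real)^n * e)"
    by (intro summable_mult2) (simp add: summable_geometric_iff)
  have "dist x y \<le> suminf (\<lambda>n. (1/2::real)^n * e)"
    unfolding dist_fun_def
  proof (rule suminf_le)
    fix n
    show "(1/2)^n * min (dist (x (from_nat n)) (y (from_nat n))) 1 \<le> (1/2::real)^n * e"
      using assms[of "from_nat n"] by (intro mult_left_mono) auto
    show "summable (\<lambda>n. (1/2::real)^n * min (dist (x (from_nat n)) (y (from_nat n))) 1)"
      by (rule summable_comparison_test'[of "\<lambda>n. (1/2)^n"]) (auto simp: summable_geometric_iff)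
  qed (rule summ)
  also have "\<dots> = suminf (\<lambda>n. (1/2::real)^n) * e"
    by (rule suminf_mult2[symmetric]) (simp add: summable_geometric_iff)
  also have "suminf (\<lambda>n. (1/2::real)^n) = 2"
    using suminf_geometric[of "1/2::real"] by simp
  finally show ?thesis by simp
qed

section \<open>Sperner parity on the Kuhn triangulation\<close>

text \<open>The label \<open>Suc m\<close> plays the role of \<open>*\<close>.\<close>

lemma ksimplex_fully_labelled_odd:
  fixes lab :: "(nat \<Rightarrow> nat) \<Rightarrow> nat"
  assumes "0 < p"
    and range: "\<And>x j. j \<le> m \<Longrightarrow> x j = p \<Longrightarrow> lab x \<le> j \<or> lab x = Suc m"
    and zero: "\<And>x j. j \<le> m \<Longrightarrow> x j = 0 \<Longrightarrow> lab x \<noteq> j"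
    and no_star: "\<And>n s. n \<le> m \<Longrightarrow> ksimplex p n s \<Longrightarrow> \<not> (insert (Suc m) {..<n} \<subseteq> lab ` s)"
    and "n \<le> m"
  shows "odd (card {s. ksimplex p n s \<and> lab ` s = {..n}})"
  using \<open>n \<le> m\<close>
proof (induction n)
  case 0
  \<comment> \<open>The constant vertex forms the only simplex of dimension 0; it is not starred, so
    \<open>range\<close> at 0 forces the label 0.\<close>
  have "lab (\<lambda>x. p) \<noteq> Suc m"
    using no_star[of 0 "{\<lambda>x. p}"] by (simp add: ksimplex_0)
  then have "lab (\<lambda>x. p) = 0"
    using range[of 0 "\<lambda>x. p"] by simp
  then show ?case
    by (simp add: ksimplex_0 cong: conj_cong)
next
  case (Suc n)
  \<comment> \<open>Kuhn's lemma in dimension \<open>Suc n\<close> admits only labels up to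
    \<open>Suc n\<close>, so larger labels, including the star, are truncated.\<close>
  define rl where "rl x = min (lab x) (Suc n)" for x
  have rl_face: "rl ` f = {..n} \<longleftrightarrow> lab ` f = {..n}" for f
  proof -
    have "rl x = lab x" if "rl x \<le> n \<or> lab x \<le> n" for x
      using that by (auto simp: rl_def)
    then show ?thesis by (metis (no_types, lifting) atMost_iff image_cong image_eqI)
  qed
  have full: "rl ` s = {..Suc n} \<longleftrightarrow> lab ` s = {..Suc n}" if s: "ksimplex p (Suc n) s" for s
  proof
    assume rl: "rl ` s = {..Suc n}"
    \<comment> \<open>Values of \<open>rl\<close> below \<open>Suc n\<close> are genuine labels.
      With all of them present, \<open>no_star\<close> excludes the star, and then
      \<open>range\<close> at coordinate \<open>Suc n\<close> shows that nothing was
      truncated.\<close>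
    have "{..<Suc n} \<subseteq> lab ` s"
    proof
      fix i assume i: "i \<in> {..<Suc n}"
      then have "i \<in> rl ` s" unfolding rl by auto
      then show "i \<in> lab ` s" using i by (auto simp: rl_def min_def split: if_splits)
    qed
    then have "Suc m \<notin> lab ` s" using no_star[OF Suc.prems s] by auto
    have "lab x \<le> Suc n" if "x \<in> s" for x
    proof -
      have "x (Suc n) = p"
        using s that by (auto elim!: ksimplex.cases dest: kuhn_simplex.out_eq_p)
      then show ?thesis
        using range[of "Suc n" x] Suc.prems \<open>Suc m \<notin> lab ` s\<close> that by (metis image_eqI)
    qed
    then have "rl x = lab x" if "x \<in> s" for x using that by (simp add: rl_def)
    then show "lab ` s = {..Suc n}" using rl by (metis image_cong)
  next
    assume "lab ` s = {..Suc n}"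
    moreover then have "rl x = lab x" if "x \<in> s" for x
      using that by (metis atMost_iff image_eqI min.absorb1 rl_def)
    ultimately show "rl ` s = {..Suc n}" by (metis image_cong)
  qed
  \<comment> \<open>On a facet \<open>x j = p\<close> with \<open>j < n\<close> only labels up to \<open>j\<close> occur, on a facet \<open>x j = 0\<close> the label
    \<open>j\<close> is missing; so only the facet \<open>x n = p\<close> contributes.\<close>
  have faces: "(\<exists>s a. ksimplex p (Suc n) s \<and> a \<in> s \<and> f = s - {a} \<and> rl ` f = {..n} \<and>
        ((\<exists>j\<le>n. \<forall>x\<in>f. x j = 0) \<or> (\<exists>j\<le>n. \<forall>x\<in>f. x j = p)))
      \<longleftrightarrow> ksimplex p n f \<and> lab ` f = {..n}" (is "?L f \<longleftrightarrow> ?R f") for f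
  proof
    assume "?L f"
    then obtain s a where s: "ksimplex p (Suc n) s" "a \<in> s" "f = s - {a}" and lab: "lab ` f = {..n}"
      and bd: "(\<exists>j\<le>n. \<forall>x\<in>f. x j = 0) \<or> (\<exists>j\<le>n. \<forall>x\<in>f. x j = p)"
      by (auto simp: rl_face)
    have "\<not> (\<exists>j\<le>n. \<forall>x\<in>f. x j = 0)"
    proof
      assume "\<exists>j\<le>n. \<forall>x\<in>f. x j = 0"
      then obtain j where j: "j \<le> n" "\<forall>x\<in>f. x j = 0" by blast
      then have "j \<in> lab ` f" using lab by auto
      then obtain x where "x \<in> f" "lab x = j" by blast
      then show False using zero[of j x] j Suc.prems by simp
    qed
    then obtain j where j: "j \<le> n" "\<forall>x\<in>f. x j = p" using bd by blast
    have "n \<in> lab ` f" using lab by auto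
    then obtain x where x: "x \<in> f" "lab x = n" by blast
    have "lab x \<le> j \<or> lab x = Suc m"
      using range[of j x] j x(1) Suc.prems by simp
    then have "j = n" using x(2) j(1) Suc.prems by simp
    then have top: "\<forall>x\<in>f. x n = p" using j by simp
    show "?R f" using simplex_top_face[OF \<open>0 < p\<close> top] s lab by blast
  next
    assume R: "?R f"
    have top: "\<forall>x\<in>f. x n = p"
      using R by (auto elim!: ksimplex.cases dest: kuhn_simplex.out_eq_p)
    then show "?L f"
      using simplex_top_face[OF \<open>0 < p\<close> top] R by (auto simp: rl_face)
  qed
  \<comment> \<open>Kuhn's lemma passes from an odd number of boundary facets, counted by the
    induction hypothesis through \<open>faces\<close>, to an odd number of full simplices.\<close>
  have "odd (card {s. ksimplex p (Suc n) s \<and> rl ` s = {..Suc n}})"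
  proof (rule kuhn_simplex_lemma)
    show "\<forall>s. ksimplex p (Suc n) s \<longrightarrow> rl ` s \<subseteq> {..Suc n}"
      by (auto simp: rl_def)
    show "odd (card {f. \<exists>s a. ksimplex p (Suc n) s \<and> a \<in> s \<and> f = s - {a} \<and> rl ` f = {..n} \<and>
        ((\<exists>j\<le>n. \<forall>x\<in>f. x j = 0) \<or> (\<exists>j\<le>n. \<forall>x\<in>f. x j = p))})"
      unfolding faces using Suc by simp
  qed
  moreover have "{s. ksimplex p (Suc n) s \<and> rl ` s = {..Suc n}} =
      {s. ksimplex p (Suc n) s \<and> lab ` s = {..Suc n}}"
    using full by blast
  ultimately show ?case by simp
qed

section \<open>Stick-breaking coordinates and mesh size\<close>

text \<open>Stick-breaking coordinates turn the triangulated cube into a simplex so that \<open>y n = 1\<close>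
  describes the face with tiles \<open>0, \<dots>, n\<close>; this matches the convention that the vertices of
  a Kuhn simplex of dimension \<open>n\<close> are maximal in all coordinates from \<open>n\<close> on.\<close>

definition stick :: "(nat \<Rightarrow> real) \<Rightarrow> nat \<Rightarrow> real" where
  "stick y i = (\<Prod>j<i. 1 - y j) * y i"

text \<open>By telescoping: the product is the length left after \<open>k\<close> pieces are broken
  off.\<close>

lemma stick_sum: "(\<Sum>i<k. stick y i) = 1 - (\<Prod>j<k. 1 - y j)"
  by (induction k) (auto simp: stick_def algebra_simps)

lemma stick_eq_0: "j < i \<Longrightarrow> y j = 1 \<Longrightarrow> stick y i = 0"
  by (auto simp: stick_def)

lemma stick_in_standard_simplex:
  assumes y: "\<And>i. 0 \<le> y i \<and> y i \<le> 1" and "y m = 1"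
  shows "stick y \<in> standard_simplex m"
proof -
  have prod: "0 \<le> (\<Prod>j<i. 1 - y j)" "(\<Prod>j<i. 1 - y j) \<le> 1" for i
    using y by (auto intro!: prod_nonneg prod_le_1)
  have "0 \<le> stick y i \<and> stick y i \<le> 1" for i
    using prod y by (auto simp: stick_def intro: mult_le_one)
  moreover have "(\<Sum>i\<le>m. stick y i) = 1"
    using stick_sum[of y "Suc m"] \<open>y m = 1\<close> by (simp flip: lessThan_Suc_atMost)
  ultimately show ?thesis
    using stick_eq_0[of m _ y] \<open>y m = 1\<close> by (auto simp: standard_simplex_def)
qed

lemma continuous_on_stick: "continuous_on A stick"
proof (rule continuous_on_coordinatewise_then_product)
  fix i
  have "continuous_on A (\<lambda>y::nat \<Rightarrow> real. y j)" for j
    by (rule continuous_on_subset[OF continuous_on_product_coordinates]) simp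
  then have "continuous_on A (\<lambda>y::nat \<Rightarrow> real. (\<Prod>j<i. 1 - y j) * y i)"
    by (intro continuous_intros)
  then show "continuous_on A (\<lambda>y. stick y i)" by (simp add: stick_def)
qed

text \<open>Each coordinate of a vertex is that of the base point or one more, so vertices of one
  simplex differ by at most 1 in each coordinate.\<close>

lemma ksimplex_mesh:
  assumes "0 < p" "ksimplex p n s" "x \<in> s" "x' \<in> s"
  shows "dist (\<lambda>i. real (x i) / p) (\<lambda>i. real (x' i) / p) \<le> 2 / p"
proof -
  obtain b u where "kuhn_simplex p n b u s" using assms(2) by (auto elim: ksimplex.cases)
  then interpret kuhn_simplex p n b u s .
  have "dist (real (x i) / p) (real (x' i) / p) \<le> 1 / p" for i
  proof -
    have "\<bar>real (x i) - real (x' i)\<bar> \<le> 1"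
      using base_le[of x i] base_le[of x' i] le_Suc_base[of x i] le_Suc_base[of x' i] assms by simp
    then show ?thesis
      using \<open>0 < p\<close> by (simp add: dist_real_def divide_right_mono flip: diff_divide_distrib)
  qed
  then show ?thesis using dist_fun_le[of "\<lambda>i. real (x i) / p" "\<lambda>i. real (x' i) / p" "1 / p"] by simp
qed

section \<open>Cuts with balanced demand\<close>

text \<open>\<open>N\<close> is the set of tiles treated as non-degenerate: the support of a starred
  vertex, or all tiles if a simplex carries all labels. Uniform continuity moves the demand bounds
  from the other vertices of the simplex to one vertex.\<close>

lemma approximate_balance:
  fixes F :: "(nat \<Rightarrow> real) \<Rightarrow> nat \<Rightarrow> real"
  assumes cont: "\<forall>i\<le>m. continuous_on (standard_simplex m) (\<lambda>z. F z i)"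
    and nonneg: "\<forall>z\<in>standard_simplex m. \<forall>i\<le>m. 0 \<le> F z i"
    and total: "\<forall>z\<in>standard_simplex m. (\<Sum>i\<le>m. F z i) = m + 1"
    and "0 < \<eta>"
  obtains z N where "z \<in> standard_simplex m" "N \<subseteq> {..m}" "\<forall>i\<le>m. i \<notin> N \<longrightarrow> z i = 0"
    "\<forall>i\<in>N. F z i \<le> 1 + \<eta>" "card N \<le> (\<Sum>i\<in>N. F z i) + 1 + \<eta>"
proof -
  \<comment> \<open>At most \<open>m + 1\<close> tiles contribute an error \<open>e\<close> each,
    together at most \<open>\<eta>\<close>.\<close>
  define e where "e = \<eta> / (m + 1)"
  have "0 < e" using \<open>0 < \<eta>\<close> by (simp add: e_def)
  \<comment> \<open>The cube of dimension \<open>m\<close>; the coordinates from \<open>m\<close> on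
    are 1, as for scaled vertices of Kuhn simplices.\<close>
  define K where "K = Pi UNIV (\<lambda>i. if i < m then {0..1::real} else {1})"
  have K: "y \<in> K \<longleftrightarrow> (\<forall>i. 0 \<le> y i \<and> y i \<le> 1 \<and> (m \<le> i \<longrightarrow> y i = 1))" for y
  proof -
    have "v \<in> (if i < m then {0..1} else {1}) \<longleftrightarrow> 0 \<le> v \<and> v \<le> 1 \<and> (m \<le> i \<longrightarrow> v = 1)" for v :: real and i
      by (cases "i < m") auto
    then show ?thesis by (simp only: K_def Pi_iff ball_UNIV)
  qed
  have "compactin (powertop_real UNIV) (PiE UNIV (\<lambda>i. if i < m then {0..1} else {1}))"
    by (simp add: compactin_PiE)
  then have "compact K"
    by (simp add: K_def PiE_UNIV_domain euclidean_product_topology)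
  have stickK: "stick y \<in> standard_simplex m" if "y \<in> K" for y
    using that by (intro stick_in_standard_simplex) (auto simp: K)
  have "\<exists>d>0. \<forall>y\<in>K. \<forall>y'\<in>K. dist y y' < d \<longrightarrow> \<bar>F (stick y) i - F (stick y') i\<bar> < e" if "i \<le> m" for i
  proof -
    have "continuous_on K (\<lambda>y. F (stick y) i)"
      using stickK by (intro continuous_on_compose2[OF cont[rule_format, OF that] continuous_on_stick]) auto
    then have "uniformly_continuous_on K (\<lambda>y. F (stick y) i)"
      using \<open>compact K\<close> by (rule compact_uniformly_continuous)
    then show ?thesis
      using \<open>0 < e\<close> unfolding uniformly_continuous_on_def dist_real_def
      by (metis dist_commute abs_minus_commute)
  qed
  then obtain d where d: "\<And>i. i \<le> m \<Longrightarrow> 0 < d i"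
    "\<And>i y y'. i \<le> m \<Longrightarrow> y \<in> K \<Longrightarrow> y' \<in> K \<Longrightarrow> dist y y' < d i \<Longrightarrow> \<bar>F (stick y) i - F (stick y') i\<bar> < e"
    by metis
  define d0 where "d0 = Min (d ` {..m})"
  have "0 < d0" using d(1) by (auto simp: d0_def)
  obtain p :: nat where p: "2 / d0 < p" using reals_Archimedean2 by blast
  moreover have "0 < 2 / d0" using \<open>0 < d0\<close> by simp
  ultimately have "0 < real p" by (rule less_trans[rotated])
  then have "0 < p" by simp
  have mesh: "2 / p < d0" using p \<open>0 < d0\<close> \<open>0 < p\<close> by (simp add: field_simps)
  define z where "z x = stick (\<lambda>i. real (x i) / p)" for x :: "nat \<Rightarrow> nat"
  have inK: "(\<lambda>i. real (x i) / p) \<in> K" if "ksimplex p n s" "x \<in> s" "n \<le> m" for n s x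
  proof -
    from that(1) obtain b u where "kuhn_simplex p n b u s" by (auto elim: ksimplex.cases)
    then interpret kuhn_simplex p n b u s .
    show ?thesis using s_le_p[OF that(2)] out_eq_p[OF that(2)] that(3) \<open>0 < p\<close> by (simp add: K)
  qed
  have close: "\<bar>F (z x) i - F (z x') i\<bar> < e"
    if "ksimplex p n s" "x \<in> s" "x' \<in> s" "n \<le> m" "i \<le> m" for n s x x' i
  proof -
    have "d0 \<le> d i" using that(5) by (simp add: d0_def)
    then have "dist (\<lambda>i. real (x i) / p) (\<lambda>i. real (x' i) / p) < d i"
      using ksimplex_mesh[OF \<open>0 < p\<close> that(1-3)] mesh by linarith
    then show ?thesis
      unfolding z_def using inK[OF that(1,2,4)] inK[OF that(1,3,4)] by (intro d(2) that(5))
  qed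
  \<comment> \<open>Requiring \<open>z x i\<close> to be nonzero yields the boundary conditions on
    labels, since \<open>x j = p\<close> makes all later tiles degenerate and \<open>x j = 0\<close>
    makes tile \<open>j\<close> degenerate.\<close>
  define good where "good x i \<longleftrightarrow> i \<le> m \<and> z x i \<noteq> 0 \<and> 1 < F (z x) i" for x i
  define lab where "lab x = (if \<exists>i. good x i then SOME i. good x i else Suc m)" for x
  have lab_good: "good x (lab x)" if "lab x \<noteq> Suc m" for x
    using that unfolding lab_def by (metis someI_ex)
  have not_good: "\<not> good x i" if "lab x = Suc m" for x i
  proof
    assume "good x i"
    then have "lab x = (SOME i. good x i)" "good x (SOME i. good x i)"
      unfolding lab_def by (auto intro: someI)
    then have "good x (Suc m)" using that by simp
    then show False by (simp add: good_def)
  qed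
  have top: "z x i = 0" if "x j = p" "j < i" for x i j
    using that \<open>0 < p\<close> stick_eq_0[of j i] by (simp add: z_def)
  have bot: "z x j = 0" if "x j = 0" for x j
    using that by (simp add: z_def stick_def)
  have "\<exists>n s. n \<le> m \<and> ksimplex p n s \<and> insert (Suc m) {..<n} \<subseteq> lab ` s \<or>
      ksimplex p m s \<and> lab ` s = {..m}"
  proof (rule ccontr)
    assume "\<not> ?thesis"
    then have no: "\<And>n s. n \<le> m \<Longrightarrow> ksimplex p n s \<Longrightarrow> \<not> insert (Suc m) {..<n} \<subseteq> lab ` s"
      "\<And>s. \<not> (ksimplex p m s \<and> lab ` s = {..m})" by blast+
    have "odd (card {s. ksimplex p m s \<and> lab ` s = {..m}})"
    proof (rule ksimplex_fully_labelled_odd[OF \<open>0 < p\<close>])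
      show "lab x \<le> j \<or> lab x = Suc m" if "j \<le> m" "x j = p" for x j
        using lab_good[of x] top[of x j "lab x"] that by (force simp: good_def)
      show "lab x \<noteq> j" if "j \<le> m" "x j = 0" for x j
        using lab_good[of x] bot[of x j] that by (force simp: good_def)
    qed (use no in auto)
    then show False using no(2) by simp
  qed
  then consider n s where "n \<le> m" "ksimplex p n s" "insert (Suc m) {..<n} \<subseteq> lab ` s"
    | s where "ksimplex p m s" "lab ` s = {..m}" by blast
  then show thesis
  proof cases
    case 1
    \<comment> \<open>At the starred vertex no tile of positive length has demand above 1, and tiles
      beyond \<open>n\<close> are degenerate. Each tile below \<open>n\<close> labels a nearby
      vertex, so its demand is at least \<open>1 - e\<close>.\<close>
    then obtain x where x: "x \<in> s" "lab x = Suc m" by auto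
    have zx: "z x \<in> standard_simplex m"
      using inK[OF 1(2) x(1) 1(1)] stickK by (simp add: z_def)
    define N where "N = {i\<in>{..m}. z x i \<noteq> 0}"
    have "x n = p"
      using 1(2) x(1) by (auto elim!: ksimplex.cases dest: kuhn_simplex.out_eq_p)
    then have Nn: "N \<subseteq> {..n}"
      using top[of x n] by (auto simp: N_def) (meson not_le_imp_less)
    have ge: "1 - e \<le> F (z x) i" if "i < n" for i
    proof -
      have "i \<in> lab ` s" using 1(3) that by auto
      then obtain x' where x': "x' \<in> s" "lab x' = i" by auto
      then have "1 < F (z x') i" using lab_good[of x'] that 1(1) by (auto simp: good_def)
      then show ?thesis using close[OF 1(2) x(1) x'(1) 1(1), of i] that 1(1) by simp
    qed
    have "finite N" by (simp add: N_def)
    \<comment> \<open>Tile \<open>n\<close> has only the lower bound 0; setting it aside accounts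
      for the summand 1 in the conclusion.\<close>
    have "card N \<le> card (N - {n}) + 1"
      using \<open>finite N\<close> by (cases "n \<in> N") (simp_all add: card_Suc_Diff1)
    moreover have "card (N - {n}) * (1 - e) \<le> (\<Sum>i\<in>N - {n}. F (z x) i)"
    proof (rule sum_bounded_below)
      fix i assume "i \<in> N - {n}"
      then have "i < n" using Nn by (simp add: subset_iff order_less_le)
      then show "1 - e \<le> F (z x) i" by (rule ge)
    qed
    moreover have "\<dots> \<le> (\<Sum>i\<in>N. F (z x) i)"
      using \<open>finite N\<close> nonneg[rule_format, OF zx] by (intro sum_mono2) (auto simp: N_def)
    moreover have "card (N - {n}) * e \<le> \<eta>"
    proof -
      have "card (N - {n}) \<le> card {..m}" using \<open>finite N\<close> by (intro card_mono) (auto simp: N_def)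
      then have "card (N - {n}) * e \<le> (m + 1) * e" using \<open>0 < e\<close> by (intro mult_right_mono) auto
      then show ?thesis by (simp add: e_def)
    qed
    ultimately have "card N \<le> (\<Sum>i\<in>N. F (z x) i) + 1 + \<eta>" by (simp add: algebra_simps)
    moreover have "F (z x) i \<le> 1 + \<eta>" if "i \<in> N" for i
      using not_good[OF x(2), of i] that \<open>0 < \<eta>\<close> by (auto simp: good_def N_def)
    ultimately show ?thesis
      using that[OF zx, of N] by (auto simp: N_def)
  next
    case 2
    then obtain x where x: "x \<in> s" by force
    have zx: "z x \<in> standard_simplex m"
      using inK[OF 2(1) x] stickK by (simp add: z_def)
    have ge: "1 - e \<le> F (z x) i" if "i \<le> m" for i
    proof -
      have "i \<in> lab ` s" using 2(2) that by auto
      then obtain x' where x': "x' \<in> s" "lab x' = i" by auto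
      then have "1 < F (z x') i" using lab_good[of x'] that by (auto simp: good_def)
      then show ?thesis using close[OF 2(1) x x'(1), of i] that by simp
    qed
    have "F (z x) i \<le> 1 + \<eta>" if "i \<le> m" for i
    proof -
      \<comment> \<open>The other \<open>m\<close> tiles take at least \<open>1 - e\<close> each out
        of the total \<open>m + 1\<close>, which caps the demand for tile \<open>i\<close>.\<close>
      have "card ({..m} - {i}) * (1 - e) \<le> (\<Sum>k\<in>{..m} - {i}. F (z x) k)"
        using ge by (intro sum_bounded_below) auto
      moreover have "(\<Sum>k\<le>m. F (z x) k) = F (z x) i + (\<Sum>k\<in>{..m} - {i}. F (z x) k)"
        using that by (intro sum.remove) auto
      ultimately have "F (z x) i \<le> 1 + m * e"
        using total[rule_format, OF zx] that by (simp add: algebra_simps)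
      also have "\<dots> \<le> 1 + (m + 1) * e" using \<open>0 < e\<close> by simp
      finally show ?thesis by (simp add: e_def)
    qed
    then show ?thesis
      using that[OF zx, of "{..m}"] total[rule_format, OF zx] \<open>0 < \<eta>\<close> by auto
  qed
qed

section \<open>Rounding fractional demands\<close>

text \<open>A set of players has total weight equal to its size. Columns in \<open>N\<close> hold at
  most \<open>1 + \<eta>\<close> each, and those outside hold at most
  \<open>m + 2 - card N + \<eta>\<close> together; as the total error is below 1, counting weight
  gives Hall's condition.\<close>

lemma assignment_of_balanced:
  fixes f :: "nat \<Rightarrow> nat \<Rightarrow> real"
  assumes nonneg: "\<forall>j i. 0 \<le> f j i"
    and row: "\<forall>j\<le>m. (\<Sum>i\<le>m. f j i) = 1"
    and N: "N \<subseteq> {..m}"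
    and col: "\<forall>i\<in>N. (\<Sum>j\<le>m. f j i) \<le> 1 + \<eta>"
    and lower: "card N \<le> (\<Sum>i\<in>N. \<Sum>j\<le>m. f j i) + 1 + \<eta>"
    and "0 < \<eta>" "(m + 2) * \<eta> < 1"
  obtains c where "c \<in> {..m} \<rightarrow>\<^sub>E {..m}" "\<forall>j\<le>m. 0 < f j (c j)"
    "inj_on c {j. j \<le> m \<and> c j \<in> N}" "card (N - c ` {..m}) \<le> 1"
proof -
  have "finite N" using N finite_subset by blast
  define out where "out j \<longleftrightarrow> (\<exists>d\<le>m. d \<notin> N \<and> 0 < f j d)" for j
  \<comment> \<open>The columns outside \<open>N\<close> are one more than the tiles outside \<open>N\<close>, and all stand for ``nothing''.
    Row \<open>Suc m\<close> is a dummy player who takes the tile that is dropped, if any.\<close>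
  define E where "E j = (if j = Suc m then {..Suc m}
    else {i\<in>N. 0 < f j i} \<union> (if out j then {..Suc m} - N else {}))" for j
  have E_sub: "E j \<subseteq> {..Suc m}" for j
    using N by (auto simp: E_def)
  have "\<exists>\<pi>. inj_on \<pi> {..Suc m} \<and> (\<forall>j\<in>{..Suc m}. \<pi> j \<in> E j)"
  proof (rule hall_marriage)
    show "finite (E j)" for j using E_sub finite_subset by blast
    fix S assume S: "S \<subseteq> {..Suc m}"
    then have "finite S" using finite_subset by blast
    show "card S \<le> card (\<Union>(E ` S))"
    proof (cases "Suc m \<in> S")
      case True
      moreover have "E (Suc m) = {..Suc m}" by (simp add: E_def)
      ultimately have "\<Union>(E ` S) = {..Suc m}" using E_sub by blast
      then show ?thesis using S card_mono by (metis finite_atMost)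
    next
      case False
      then have Sm: "S \<subseteq> {..m}" using S by (force simp: subset_iff le_Suc_eq)
      \<comment> \<open>\<open>T\<close> collects the tiles of \<open>N\<close> wanted in
        \<open>S\<close>; \<open>X\<close> is the weight that \<open>S\<close> puts outside
        \<open>N\<close>.\<close>
      define T where "T = {i\<in>N. \<exists>j\<in>S. 0 < f j i}"
      define X where "X = (\<Sum>i\<in>{..m} - N. \<Sum>j\<in>S. f j i)"
      have "T \<subseteq> N" "finite T" using \<open>finite N\<close> by (auto simp: T_def)
      have colS: "(\<Sum>j\<in>S. f j i) \<le> (\<Sum>j\<le>m. f j i)" for i
        using Sm nonneg by (intro sum_mono2) auto
      have "real (card S) = (\<Sum>j\<in>S. \<Sum>i\<le>m. f j i)"
        using row Sm by (simp add: subset_iff)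
      also have "\<dots> = (\<Sum>i\<le>m. \<Sum>j\<in>S. f j i)" by (rule sum.swap)
      also have "\<dots> = X + (\<Sum>i\<in>N. \<Sum>j\<in>S. f j i)"
        unfolding X_def using N by (intro sum.subset_diff) auto
      also have "(\<Sum>i\<in>N. \<Sum>j\<in>S. f j i) = (\<Sum>i\<in>T. \<Sum>j\<in>S. f j i)"
        using \<open>finite N\<close> \<open>T \<subseteq> N\<close> nonneg
        by (intro sum.mono_neutral_right ballI sum.neutral) (force simp: T_def intro: antisym simp: not_less)+
      also have "\<dots> \<le> (\<Sum>i\<in>T. 1 + \<eta>)"
        using col colS \<open>T \<subseteq> N\<close> by (intro sum_mono) (meson order_trans subsetD)
      finally have cardS: "card S \<le> X + card T + card T * \<eta>"
        by (simp add: algebra_simps)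
      have "card T \<le> card {..m}" using \<open>T \<subseteq> N\<close> N by (intro card_mono) auto
      then have "(card T + 1) * \<eta> \<le> (m + 2) * \<eta>"
        using \<open>0 < \<eta>\<close> by (intro mult_right_mono) auto
      \<comment> \<open>All errors add up to less than 1, so the inequality between cardinalities
        survives without them.\<close>
      then have small: "card T * \<eta> + \<eta> < 1"
        using assms(7) by (simp add: algebra_simps)
      show ?thesis
      proof (cases "\<exists>j\<in>S. out j")
        case True
        then have "\<Union>(E ` S) = T \<union> ({..Suc m} - N)"
          using False by (auto simp: E_def T_def split: if_splits)
        moreover have "card N \<le> m + 1" using N card_mono[of "{..m}" N] by simp
        moreover have "card (T \<union> ({..Suc m} - N)) = card T + (m + 2 - card N)"
        proof -
          have "card ({..Suc m} - N) = m + 2 - card N"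
            using N \<open>finite N\<close> by (subst card_Diff_subset) auto
          then show ?thesis
            using \<open>T \<subseteq> N\<close> \<open>finite T\<close> by (subst card_Un_disjoint) auto
        qed
        ultimately have "real (card (\<Union>(E ` S))) = card T + (m + 2) - real (card N)"
          by (simp add: of_nat_diff)
        \<comment> \<open>The total demand is \<open>m + 1\<close>, and by \<open>lower\<close> at
          least \<open>card N - 1 - \<eta>\<close> of it falls in \<open>N\<close>.\<close>
        moreover have "X \<le> m + 2 - real (card N) + \<eta>"
        proof -
          have "X \<le> (\<Sum>i\<in>{..m} - N. \<Sum>j\<le>m. f j i)"
            unfolding X_def by (intro sum_mono colS)
          moreover have "(\<Sum>i\<le>m. \<Sum>j\<le>m. f j i) =
              (\<Sum>i\<in>{..m} - N. \<Sum>j\<le>m. f j i) + (\<Sum>i\<in>N. \<Sum>j\<le>m. f j i)"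
            using N by (intro sum.subset_diff) auto
          moreover have "(\<Sum>i\<le>m. \<Sum>j\<le>m. f j i) = m + 1"
            using row by (subst sum.swap) simp
          ultimately show ?thesis using lower by linarith
        qed
        ultimately show ?thesis using cardS small by linarith
      next
        case no_out: False
        have "f j i = 0" if "i \<in> {..m} - N" "j \<in> S" for i j
        proof -
          have "\<not> 0 < f j i" using no_out that by (auto simp: out_def)
          then show ?thesis using nonneg by (simp add: not_less antisym)
        qed
        then have "X = 0" by (simp add: X_def)
        moreover have "\<Union>(E ` S) = T"
          using False no_out by (auto simp: E_def T_def)
        moreover have "card S \<le> card T"
          using \<open>X = 0\<close> cardS small \<open>0 < \<eta>\<close> by linarith
        ultimately show ?thesis by simp
      qed
    qed
  qed simp
  then obtain \<pi> where \<pi>: "inj_on \<pi> {..Suc m}" "\<And>j. j \<le> Suc m \<Longrightarrow> \<pi> j \<in> E j" by auto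
  \<comment> \<open>There are as many rows as columns, so the matching is onto: every tile of
    \<open>N\<close> goes to a player or to the dummy.\<close>
  have surj: "\<pi> ` {..Suc m} = {..Suc m}"
  proof (rule endo_inj_surj[OF finite_atMost _ \<pi>(1)])
    show "\<pi> ` {..Suc m} \<subseteq> {..Suc m}" using \<pi>(2) E_sub by blast
  qed
  \<comment> \<open>A matched column outside \<open>N\<close> need not be a tile that the player
    wants, and may be the extra column; it is replaced by a tile outside \<open>N\<close> with
    positive weight. The value \<open>undefined\<close> makes \<open>c\<close> extensional.\<close>
  define c where "c j = (if j \<le> m then if \<pi> j \<in> N then \<pi> j else SOME d. d \<le> m \<and> d \<notin> N \<and> 0 < f j d
    else undefined)" for j
  have c: "c j \<le> m \<and> 0 < f j (c j) \<and> (\<pi> j \<in> N \<longrightarrow> c j = \<pi> j) \<and> (\<pi> j \<notin> N \<longrightarrow> c j \<notin> N)" if "j \<le> m" for j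
  proof -
    have E: "\<pi> j \<in> N \<and> 0 < f j (\<pi> j) \<or> \<pi> j \<notin> N \<and> out j"
      using \<pi>(2)[of j] that by (auto simp: E_def split: if_splits)
    show ?thesis
    proof (cases "\<pi> j \<in> N")
      case True
      then have "c j = \<pi> j" using that by (simp add: c_def)
      then show ?thesis using True E N by auto
    next
      case False
      then have "\<exists>d. d \<le> m \<and> d \<notin> N \<and> 0 < f j d" using E by (auto simp: out_def)
      from someI_ex[OF this] show ?thesis using that False by (simp add: c_def)
    qed
  qed
  have c_eq: "c j = \<pi> j" if "j \<le> m" "c j \<in> N" for j
    using c[OF that(1)] that(2) by blast
  show thesis
  proof
    show "c \<in> {..m} \<rightarrow>\<^sub>E {..m}"
    proof (rule PiE_I)
      show "c j \<in> {..m}" if "j \<in> {..m}" for j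
        using c that by (meson atMost_iff)
    qed (simp add: c_def)
    show "\<forall>j\<le>m. 0 < f j (c j)" using c by blast
    show "inj_on c {j. j \<le> m \<and> c j \<in> N}"
    proof (rule inj_onI)
      fix j k assume jk: "j \<in> {j. j \<le> m \<and> c j \<in> N}" "k \<in> {j. j \<le> m \<and> c j \<in> N}"
      assume eq: "c j = c k"
      have "c j = \<pi> j" "c k = \<pi> k" using c_eq jk by blast+
      then have "\<pi> j = \<pi> k" using eq by metis
      then show "j = k" by (rule inj_onD[OF \<pi>(1)]) (use jk in auto)
    qed
    have "N - c ` {..m} \<subseteq> {\<pi> (Suc m)}"
    proof
      fix i assume i: "i \<in> N - c ` {..m}"
      then have "i \<in> \<pi> ` {..Suc m}" using surj N by auto
      then obtain k where "k \<le> Suc m" "i = \<pi> k" by auto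
      moreover have False if "k \<le> m"
        using c[OF that] i \<open>i = \<pi> k\<close> that by (metis DiffE atMost_iff image_eqI)
      ultimately show "i \<in> {\<pi> (Suc m)}" by (auto simp: le_Suc_eq)
    qed
    then show "card (N - c ` {..m}) \<le> 1"
      using card_mono[of "{\<pi> (Suc m)}" "N - c ` {..m}"] by simp
  qed
qed

section \<open>Approximate divisions and their limit\<close>

text \<open>The choice \<open>c j\<close> of player \<open>j\<close> is read as ``nothing'' when it lies outside \<open>N\<close>.  Tiles of \<open>N\<close>
  may be degenerate, which makes the condition stable under limits of \<open>z\<close>.\<close>

definition one_drop_assignment :: "nat \<Rightarrow> (nat \<Rightarrow> real) \<Rightarrow> nat set \<Rightarrow> (nat \<Rightarrow> nat) \<Rightarrow> bool" where
  "one_drop_assignment m z N c \<longleftrightarrow> N \<subseteq> {..m} \<and> (\<forall>i\<le>m. i \<notin> N \<longrightarrow> z i = 0) \<and> c \<in> {..m} \<rightarrow>\<^sub>E {..m} \<and>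
     inj_on c {j. j \<le> m \<and> c j \<in> N} \<and> card (N - c ` {..m}) \<le> 1"

text \<open>Normalising the weights \<open>max 0 (\<delta> - infdist z (A i j))\<close> is possible
  because of the covering, and a positive weight certifies that \<open>z\<close> is within
  \<open>\<delta>\<close> of the set.\<close>

lemma approximate_division:
  fixes A :: preferences
  assumes cover: "\<forall>j\<le>m. (\<Union>i\<le>m. A i j) = standard_simplex m" and "0 < \<delta>"
  obtains z N c where "z \<in> standard_simplex m" "one_drop_assignment m z N c"
    "\<forall>j\<le>m. A (c j) j \<noteq> {} \<and> infdist z (A (c j) j) < \<delta>"
proof -
  \<comment> \<open>\<open>infdist\<close> is 0 to the empty set, hence the case distinction.\<close>
  define w where "w z j i = (if A i j = {} then 0 else max 0 (\<delta> - infdist z (A i j)))" for z i j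
  define W where "W z j = (\<Sum>i\<le>m. w z j i)" for z j
  define f where "f z j i = w z j i / W z j" for z j i
  have w0: "0 \<le> w z j i" for z j i by (simp add: w_def)
  have Wpos: "0 < W z j" if "z \<in> standard_simplex m" "j \<le> m" for z j
  proof -
    have "z \<in> (\<Union>i\<le>m. A i j)" using that cover by simp
    then obtain i where i: "i \<le> m" "z \<in> A i j" by blast
    then have "w z j i = \<delta>" using \<open>0 < \<delta>\<close> by (auto simp: w_def)
    moreover have "w z j i \<le> W z j"
      unfolding W_def using i w0 by (intro member_le_sum) auto
    ultimately show ?thesis using \<open>0 < \<delta>\<close> by simp
  qed
  have f0: "0 \<le> f z j i" for z j i
    by (simp add: f_def W_def w0 sum_nonneg)
  have row: "(\<Sum>i\<le>m. f z j i) = 1" if "z \<in> standard_simplex m" "j \<le> m" for z j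
    using Wpos[OF that] unfolding f_def W_def by (simp flip: sum_divide_distrib)
  have cw: "continuous_on U (\<lambda>z. w z j i)" for U j i
    by (cases "A i j = {}") (auto simp: w_def intro!: continuous_intros)
  have cont: "\<forall>i\<le>m. continuous_on (standard_simplex m) (\<lambda>z. \<Sum>j\<le>m. f z j i)"
    unfolding f_def
  proof (intro allI impI continuous_on_sum continuous_on_divide cw ballI)
    show "continuous_on (standard_simplex m) (\<lambda>z. W z j)" for j
      unfolding W_def by (intro continuous_on_sum cw)
    show "W z j \<noteq> 0" if "j \<in> {..m}" "z \<in> standard_simplex m" for j z
      using Wpos[of z j] that by auto
  qed
  have total: "\<forall>z\<in>standard_simplex m. (\<Sum>i\<le>m. \<Sum>j\<le>m. f z j i) = real m + 1"
    using row by (subst sum.swap) simp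
  \<comment> \<open>Chosen so that \<open>(m + 2) * \<eta> < 1\<close>, as rounding
    requires.\<close>
  define \<eta> :: real where "\<eta> = 1 / (m + 3)"
  have \<eta>: "0 < \<eta>" "(m + 2) * \<eta> < 1" by (simp_all add: \<eta>_def field_simps)
  have F0: "\<forall>z\<in>standard_simplex m. \<forall>i\<le>m. 0 \<le> (\<Sum>j\<le>m. f z j i)"
    by (simp add: f0 sum_nonneg)
  obtain z N where z: "z \<in> standard_simplex m" and N: "N \<subseteq> {..m}" "\<forall>i\<le>m. i \<notin> N \<longrightarrow> z i = 0"
    "\<forall>i\<in>N. (\<Sum>j\<le>m. f z j i) \<le> 1 + \<eta>" "card N \<le> (\<Sum>i\<in>N. \<Sum>j\<le>m. f z j i) + 1 + \<eta>"
    by (rule approximate_balance[OF cont F0 total \<eta>(1)]) (rule that)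
  obtain c where c: "c \<in> {..m} \<rightarrow>\<^sub>E {..m}" "\<forall>j\<le>m. 0 < f z j (c j)"
    "inj_on c {j. j \<le> m \<and> c j \<in> N}" "card (N - c ` {..m}) \<le> 1"
    using assignment_of_balanced[of "f z" m N \<eta>] f0 row z N(1,3,4) \<eta> by blast
  have "\<forall>j\<le>m. A (c j) j \<noteq> {} \<and> infdist z (A (c j) j) < \<delta>"
    using c(2) Wpos[OF z] by (auto simp: f_def w_def zero_less_divide_iff split: if_splits)
  moreover have "one_drop_assignment m z N c"
    using N(1,2) c(1,3,4) by (simp add: one_drop_assignment_def)
  ultimately show thesis using that z by blast
qed

text \<open>There are only finitely many pairs \<open>(N, c)\<close>, so a single one serves
  infinitely many tolerances \<open>1 / Suc k\<close>; for it, a convergent subsequence of cuts has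
  a limit in the closed preference sets.\<close>

lemma exact_division:
  fixes A :: preferences
  assumes cover: "\<forall>j\<le>m. (\<Union>i\<le>m. A i j) = standard_simplex m"
    and closed: "\<forall>i\<le>m. \<forall>j\<le>m. closed (A i j)"
  obtains z N c where "z \<in> standard_simplex m" "one_drop_assignment m z N c" "\<forall>j\<le>m. z \<in> A (c j) j"
proof -
  define ok where "ok k z = (\<lambda>(N, c). z \<in> standard_simplex m \<and> one_drop_assignment m z N c \<and>
    (\<forall>j\<le>m. A (c j) j \<noteq> {} \<and> infdist z (A (c j) j) < 1 / Suc k))" for k z
  define B where "B = Pow {..m} \<times> ({..m} \<rightarrow>\<^sub>E {..m})"
  have "\<exists>z. \<exists>q\<in>B. ok k z q" for k
  proof -
    have "0 < 1 / real (Suc k)" by simp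
    then obtain z N c where "z \<in> standard_simplex m" and zNc: "one_drop_assignment m z N c"
      "\<forall>j\<le>m. A (c j) j \<noteq> {} \<and> infdist z (A (c j) j) < 1 / Suc k"
      using approximate_division[OF cover] by blast
    then have "ok k z (N, c)" by (simp add: ok_def)
    moreover have "(N, c) \<in> B" using zNc(1) by (simp add: B_def one_drop_assignment_def)
    ultimately show ?thesis by blast
  qed
  then obtain z where z: "\<And>k. \<exists>q\<in>B. ok k (z k) q" by metis
  have "finite B" by (simp add: B_def finite_PiE)
  then obtain q where q: "q \<in> B" "infinite {k. ok k (z k) q}"
    using pigeonhole_infinite_rel[of UNIV B "\<lambda>k. ok k (z k)"] z by auto
  then obtain s :: "nat \<Rightarrow> nat" where s: "strict_mono s" "\<And>k. ok (s k) (z (s k)) q"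
    using infinite_enumerate[OF q(2)] by auto
  obtain N c where Nc: "q = (N, c)" by fastforce
  note ok = s(2)[unfolded Nc ok_def prod.case]
  have "compact (standard_simplex m)"
    using compactin_standard_simplex[of m] by (simp add: euclidean_product_topology)
  moreover have "\<forall>k. z (s k) \<in> standard_simplex m" using ok by simp
  ultimately obtain y t where y: "y \<in> standard_simplex m" and t: "strict_mono t"
    and "((\<lambda>k. z (s k)) \<circ> t) \<longlonglongrightarrow> y"
    by (metis compact_imp_seq_compact seq_compactE)
  then have lim: "(\<lambda>k. z (s (t k))) \<longlonglongrightarrow> y" by (simp add: o_def)
  \<comment> \<open>Of the conditions in \<open>one_drop_assignment\<close> only the vanishing
    outside \<open>N\<close> involves the cut, and it passes to the limit.\<close>
  have y0: "y i = 0" if "i \<le> m" "i \<notin> N" for i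
  proof -
    have "(\<lambda>k. z (s (t k)) i) \<longlonglongrightarrow> y i"
      using continuous_on_tendsto_compose[OF continuous_on_product_coordinates[of i] lim] by simp
    moreover have "z (s (t k)) i = 0" for k
      using ok[of "t k"] that by (simp add: one_drop_assignment_def)
    ultimately show ?thesis by (simp add: LIMSEQ_const_iff)
  qed
  have "y \<in> A (c j) j" if "j \<le> m" for j
  proof -
    have "c j \<le> m" using q(1) that by (auto simp: B_def Nc)
    have "(\<lambda>k. infdist (z (s (t k))) (A (c j) j)) \<longlonglongrightarrow> infdist y (A (c j) j)"
      by (intro tendsto_infdist lim)
    moreover have "(\<lambda>k. infdist (z (s (t k))) (A (c j) j)) \<longlonglongrightarrow> 0"
    proof (rule tendsto_sandwich[of "\<lambda>_. 0" _ _ "\<lambda>k. 1 / real (Suc k)"])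
      show "(\<lambda>k. 1 / real (Suc k)) \<longlonglongrightarrow> 0" by (rule lim_1_over_n[THEN LIMSEQ_Suc])
      have "infdist (z (s (t k))) (A (c j) j) \<le> 1 / Suc k" for k
      proof -
        \<comment> \<open>The index after both extractions is at least \<open>k\<close>, so its
          tolerance is at most \<open>1 / Suc k\<close>.\<close>
        have "k \<le> s (t k)" using s(1) t by (meson order_trans seq_suble)
        then have "1 / Suc (s (t k)) \<le> 1 / real (Suc k)" by (intro divide_left_mono) auto
        then show ?thesis using ok[of "t k"] that by (meson less_le_trans less_imp_le)
      qed
      then show "\<forall>\<^sub>F k in sequentially. infdist (z (s (t k))) (A (c j) j) \<le> 1 / real (Suc k)"
        by (intro always_eventually) simp
    qed (auto simp: infdist_nonneg)
    ultimately have "infdist y (A (c j) j) = 0" by (rule LIMSEQ_unique)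
    then show ?thesis
      using in_closed_iff_infdist_zero[OF closed[rule_format, OF \<open>c j \<le> m\<close> that]] ok that by blast
  qed
  moreover have "one_drop_assignment m y N c"
    using ok y0 by (simp add: one_drop_assignment_def)
  ultimately show thesis using that y by blast
qed

section \<open>The division with at most one dropped tile\<close>

theorem corollary3p2:
  fixes r :: nat and A :: "nat \<Rightarrow> nat \<Rightarrow> (nat \<Rightarrow> real) set"
  assumes "prime r \<or> r = 4"
    and "\<forall>i<r. \<forall>j<r. A i j \<subseteq> cuts r"
    and "closed_preferences r A"
    and "covering_preferences r A"
    and "P_dte r A"
    and "\<exists>\<epsilon>>0. \<forall>j<r. \<forall>z\<in>cuts r. 0 < z (r - 1) \<and> z (r - 1) < \<epsilon> \<longrightarrow> z \<notin> A (r - 1) j"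
  shows "\<exists>z\<in>cuts r. \<exists>\<tau> :: nat \<Rightarrow> nat option.
      (\<forall>j<r. \<forall>i. \<tau> j = Some i \<longrightarrow> i < r \<and> \<not> degenerate z i \<and> z \<in> A i j) \<and>
      (\<forall>j<r. \<tau> j = None \<longrightarrow> (\<exists>m<r. degenerate z m \<and> z \<in> A m j)) \<and>
      (\<forall>i<r. \<not> degenerate z i \<longrightarrow> card {j. j < r \<and> \<tau> j = Some i} \<le> 1) \<and>
      card {i. dropped r z \<tau> i} \<le> 1"
proof -
  have "0 < r" using assms(1) prime_gt_0_nat by auto
  then obtain m where r: "r = Suc m" using gr0_conv_Suc by blast
  have "compact (standard_simplex m)"
    using compactin_standard_simplex[of m] by (simp add: euclidean_product_topology)
  then have "closed (standard_simplex m)" by (rule compact_imp_closed)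
  moreover have "\<forall>i\<le>m. \<forall>j\<le>m. closedin (top_of_set (standard_simplex m)) (A i j)"
    using assms(3) by (simp add: closed_preferences_def cuts_def r less_Suc_eq_le)
  ultimately have closed: "\<forall>i\<le>m. \<forall>j\<le>m. closed (A i j)"
    using closedin_closed_trans by blast
  have cover: "\<forall>j\<le>m. (\<Union>i\<le>m. A i j) = standard_simplex m"
    using assms(4) by (simp add: covering_preferences_def cuts_def r lessThan_Suc_atMost less_Suc_eq_le)
  obtain z N c where z: "z \<in> standard_simplex m" and ass: "one_drop_assignment m z N c"
    and c: "\<forall>j\<le>m. z \<in> A (c j) j"
    by (rule exact_division[OF cover closed]) (rule that)
  have N: "N \<subseteq> {..m}" "\<And>i. i \<le> m \<Longrightarrow> i \<notin> N \<Longrightarrow> z i = 0" and c_PiE: "c \<in> {..m} \<rightarrow>\<^sub>E {..m}"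
    and inj: "inj_on c {j. j \<le> m \<and> c j \<in> N}" and card: "card (N - c ` {..m}) \<le> 1"
    using ass unfolding one_drop_assignment_def by blast+
  have cm: "c j \<le> m" if "j \<le> m" for j using c_PiE that by auto
  \<comment> \<open>"Nothing" is decided by the actual length of the chosen tile, since tiles of
    \<open>N\<close> may have become degenerate in the limit. The degenerate \<open>c j\<close> is
    then itself the witness for preferring nothing.\<close>
  define \<tau> where "\<tau> j = (if z (c j) = 0 then None else Some (c j))" for j
  have "card {j. j < r \<and> \<tau> j = Some i} \<le> 1" if "i < r" "\<not> degenerate z i" for i
  proof -
    have "i \<in> N" using that N(2)[of i] by (auto simp: degenerate_def r less_Suc_eq_le)
    have "j = j'" if "j \<in> {j. j < r \<and> \<tau> j = Some i}" "j' \<in> {j. j < r \<and> \<tau> j = Some i}" for j j'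
    proof -
      have "c j = i" "c j' = i" using that by (auto simp: \<tau>_def split: if_splits)
      then show ?thesis
        using inj_onD[OF inj, of j j'] that \<open>i \<in> N\<close> by (simp add: r less_Suc_eq_le)
    qed
    then show ?thesis by (simp add: card_le_Suc0_iff_eq)
  qed
  moreover have "card {i. dropped r z \<tau> i} \<le> 1"
  proof -
    \<comment> \<open>A dropped tile is non-degenerate, hence in \<open>N\<close>, and a player
      choosing it would have received it.\<close>
    have "{i. dropped r z \<tau> i} \<subseteq> N - c ` {..m}"
      using N(2) by (force simp: dropped_def degenerate_def \<tau>_def r less_Suc_eq_le)
    then have "card {i. dropped r z \<tau> i} \<le> card (N - c ` {..m})"
      using N(1) by (intro card_mono) (auto intro: finite_subset)
    then show ?thesis using card by simp
  qed
  moreover have "z \<in> cuts r" using z by (simp add: cuts_def r)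
  moreover have "\<forall>j<r. \<forall>i. \<tau> j = Some i \<longrightarrow> i < r \<and> \<not> degenerate z i \<and> z \<in> A i j"
    using c cm by (auto simp: \<tau>_def degenerate_def r less_Suc_eq_le split: if_splits)
  moreover have "\<forall>j<r. \<tau> j = None \<longrightarrow> (\<exists>m<r. degenerate z m \<and> z \<in> A m j)"
    using c cm by (auto simp: \<tau>_def degenerate_def r less_Suc_eq_le split: if_splits)
  ultimately show ?thesis by blast
qed

end
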